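(* Let $k\ge 1$ be an integer and let $n=3^k-1$. Then $b(n)=n/2$.
   Context: The odd cover number $b(n)$ of the complete graph $K_n$ is the minimum number of complete bipartite graphs needed so that each edge of $K_n$ is in an odd number of these complete bipartite graphs. Here a complete bipartite graph is specified by two disjoint sets $A_1,A_2$ of vertices of $K_n$ (not necessarily covering the whole vertex set), and consists of all edges with one endpoint in $A_1$ and the other in $A_2$. *)

theory Defs
  imports Complex_Main "HOL-Library.Multiset"
begin

definition complete_edges :: "'a set \<Rightarrow> 'a set set" where
  "complete_edges V = {e. e \<subseteq> V \<and> card e = 2}"

definition biclique_edges :: "'a set \<times> 'a set \<Rightarrow> 'a set set" where
  "biclique_edges P = {{a, b} | a b. a \<in> fst P \<and> b \<in> snd P}"

text \<open>
  A complete bipartite graph in the complete graph on \<open>V\<close> is given by its two parts. The parts need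
  not cover \<open>V\<close> and may be empty, and a complete bipartite graph may be used repeatedly; neither of
  these liberties changes the minimum below, since edgeless members and pairs of equal members can
  be dropped.
\<close>

definition odd_cover :: "'a set \<Rightarrow> ('a set \<times> 'a set) multiset \<Rightarrow> bool" where
  "odd_cover V C \<longleftrightarrow>
     (\<forall>P \<in># C. fst P \<subseteq> V \<and> snd P \<subseteq> V \<and> fst P \<inter> snd P = {}) \<and>
     (\<forall>e \<in> complete_edges V. odd (size {# P \<in># C. e \<in> biclique_edges P #}))"

definition odd_cover_number :: "nat \<Rightarrow> nat" where
  "odd_cover_number n = (LEAST m. \<exists>C. odd_cover {..<n} C \<and> size C = m)"

text \<open>The minimum is over a nonempty set: stars give an odd cover.\<close>

lemma odd_cover_exists: "\<exists>C. odd_cover {..<n::nat} C"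
proof (intro exI)
  let ?S = "\<lambda>i. ({i}, {i<..<n})"
  let ?C = "image_mset ?S (mset_set {..<n})"
  have "odd (size {# P \<in># ?C. e \<in> biclique_edges P #})" if e: "e \<in> complete_edges {..<n}" for e
  proof -
    from e obtain u v where uv: "e = {u, v}" "u \<noteq> v" "u < n" "v < n"
      unfolding complete_edges_def card_2_iff by auto
    then have "e = {min u v, max u v}" "min u v < max u v" "max u v < n"
      by (auto simp: min_def max_def)
    then obtain x y where xy: "e = {x, y}" "x < y" "y < n"
      by blast
    have "e \<in> biclique_edges (?S i) \<longleftrightarrow> i = x" for i
      using xy unfolding biclique_edges_def by (auto simp: doubleton_eq_iff)
    then have "{# P \<in># ?C. e \<in> biclique_edges P #} = image_mset ?S {# i \<in># mset_set {..<n}. i = x #}"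
      by (simp add: filter_mset_image_mset)
    moreover have "{i. i < n \<and> i = x} = {x}" using xy by auto
    ultimately show ?thesis by simp
  qed
  then show "odd_cover {..<n} ?C"
    unfolding odd_cover_def by auto
qed

lemma odd_cover_number_attained:
  "\<exists>C. odd_cover {..<n} C \<and> size C = odd_cover_number n"
proof -
  have "\<exists>m C. odd_cover {..<n} C \<and> size C = m"
    using odd_cover_exists by blast
  then show ?thesis unfolding odd_cover_number_def by (rule LeastI_ex)
qed

lemma odd_cover_number_le: "odd_cover {..<n} C \<Longrightarrow> odd_cover_number n \<le> size C"
  unfolding odd_cover_number_def by (rule Least_le) blast

end

theory Submission
  imports Defs "HOL-Library.FuncSet" "HOL-Library.Numeral_Type" "HOL-Library.Function_Algebras"
begin

text \<open>
  Lower bound: with fewer than \<open>n / 2\<close> bicliques there are fewer than \<open>n\<close> parts, so two vertex sets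
  meet every part with the same parities and their symmetric difference \<open>Z\<close> meets every part evenly.
  For each vertex \<open>v\<close>, counting the pairs of a biclique and an edge of it from \<open>v\<close> to \<open>Z\<close> shows that
  \<open>Z - {v}\<close> has even size. Hence \<open>Z\<close> is odd and contains every vertex, which is absurd for even \<open>n\<close>.

  Upper bound: take the nonzero vectors of \<open>F\<^sub>3\<^sup>k\<close> as vertices and, for each nonzero functional \<open>f\<close>
  up to sign, the biclique between \<open>f = 1\<close> and \<open>f = -1\<close>. The number of bicliques containing the edge
  \<open>uv\<close> is the number of \<open>f\<close> with \<open>f u = 1\<close> and \<open>f v = -1\<close>, the size of a nonempty affine subspace,
  which is odd because point reflection in a member fixes only that member.
\<close>

section \<open>Lower bound: parities of intersections\<close>

text \<open>Pigeonhole on the parity patterns \<open>\<phi>\<close> stands in for a dimension count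
  over F_2: \<open>V\<close> has more subsets than there are patterns.\<close>

lemma ex_nonempty_even_intersections:
  assumes "finite V" and "finite \<F>" and "card \<F> < card V"
  shows "\<exists>Z\<subseteq>V. Z \<noteq> {} \<and> (\<forall>F\<in>\<F>. even (card (Z \<inter> F)))"
proof -
  define \<phi> where "\<phi> X = {F \<in> \<F>. even (card (X \<inter> F))}" for X
  have "card (Pow \<F>) < card (Pow V)"
    using assms by (simp add: card_Pow)
  moreover have "\<phi> ` Pow V \<subseteq> Pow \<F>"
    by (auto simp: \<phi>_def)
  ultimately have "\<not> inj_on \<phi> (Pow V)"
    using assms by (meson card_inj_on_le finite_Pow_iff not_le)
  then obtain X Y where XY: "X \<subseteq> V" "Y \<subseteq> V" "X \<noteq> Y" "\<phi> X = \<phi> Y"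
    by (auto simp: inj_on_def)
  have fin: "finite X" "finite Y"
    using XY assms(1) finite_subset by blast+
  have "even (card ((X - Y \<union> (Y - X)) \<inter> F))" if "F \<in> \<F>" for F
  proof -
    have "card (X \<inter> F) = card ((X - Y) \<inter> F) + card (X \<inter> Y \<inter> F)"
      by (subst card_Un_disjoint[symmetric]) (use fin in \<open>auto intro: arg_cong[where f = card]\<close>)
    moreover have "card (Y \<inter> F) = card ((Y - X) \<inter> F) + card (X \<inter> Y \<inter> F)"
      by (subst card_Un_disjoint[symmetric]) (use fin in \<open>auto intro: arg_cong[where f = card]\<close>)
    moreover have "card ((X - Y \<union> (Y - X)) \<inter> F) = card ((X - Y) \<inter> F) + card ((Y - X) \<inter> F)"
      by (subst card_Un_disjoint[symmetric]) (use fin in \<open>auto intro: arg_cong[where f = card]\<close>)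
    moreover have "even (card (X \<inter> F)) \<longleftrightarrow> even (card (Y \<inter> F))"
      using XY(4) that by (auto simp: \<phi>_def set_eq_iff)
    ultimately show ?thesis
      by simp presburger
  qed
  moreover have "X - Y \<union> (Y - X) \<noteq> {}" "X - Y \<union> (Y - X) \<subseteq> V"
    using XY by auto
  ultimately show ?thesis
    by blast
qed

text \<open>Double counting: the sum counts the pairs of \<open>z\<close> and \<open>P\<close> with
  \<open>Q z P\<close>, and each member of \<open>C\<close>, taken with multiplicity, contributes an
  even number of them.\<close>

lemma even_sum_size_filter_mset:
  assumes "finite A" and "\<And>P. P \<in># C \<Longrightarrow> even (card {z \<in> A. Q z P})"
  shows "even (\<Sum>z\<in>A. size {# P \<in># C. Q z P #})"
  using assms(2)
proof (induction C)
  case (add P C)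
  have "(\<Sum>z\<in>A. size {# R \<in># add_mset P C. Q z R #})
      = (\<Sum>z\<in>A. size {# R \<in># C. Q z R #} + of_bool (Q z P))"
    by (intro sum.cong) auto
  also have "\<dots> = (\<Sum>z\<in>A. size {# R \<in># C. Q z R #}) + card {z \<in> A. Q z P}"
    using assms(1) by (simp add: sum.distrib Int_def)
  finally show ?case
    using add by simp
qed simp

lemma edge_mem_biclique_edges:
  "{x, y} \<in> biclique_edges (A, B) \<longleftrightarrow> x \<in> A \<and> y \<in> B \<or> y \<in> A \<and> x \<in> B"
  by (auto simp: biclique_edges_def doubleton_eq_iff)

lemma card_le_odd_cover:
  assumes "odd_cover V C" and "finite V" and "even (card V)"
  shows "card V \<le> 2 * size C"
proof (rule ccontr)
  assume less: "\<not> ?thesis"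
  let ?F = "fst ` set_mset C \<union> snd ` set_mset C"
  have card_C: "card (set_mset C) \<le> size C"
    by (induction C) (auto simp: card_insert_if)
  have "card ?F \<le> card (fst ` set_mset C) + card (snd ` set_mset C)"
    by (rule card_Un_le)
  also have "\<dots> \<le> 2 * size C"
    using card_image_le[of "set_mset C" fst] card_image_le[of "set_mset C" snd] card_C by simp
  finally have "card ?F < card V"
    using less by simp
  then have "\<exists>Z\<subseteq>V. Z \<noteq> {} \<and> (\<forall>F\<in>?F. even (card (Z \<inter> F)))"
    using assms(2) by (intro ex_nonempty_even_intersections) auto
  then obtain Z where Z: "Z \<subseteq> V" "Z \<noteq> {}" and ev: "\<forall>F\<in>?F. even (card (Z \<inter> F))"
    by (elim exE conjE)
  have finZ: "finite Z"
    using Z(1) assms(2) finite_subset by blast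
  have even_Z: "even (card (Z - {v}))" if v: "v \<in> V" for v
  proof -
    let ?s = "\<lambda>z. size {# P \<in># C. {v, z} \<in> biclique_edges P #}"
    have "even (card {z \<in> Z - {v}. {v, z} \<in> biclique_edges P})" if P: "P \<in># C" for P
    proof -
      have disj: "fst P \<inter> snd P = {}"
        using assms(1) P by (auto simp: odd_cover_def)
      have *: "{v, z} \<in> biclique_edges P \<longleftrightarrow> v \<in> fst P \<and> z \<in> snd P \<or> z \<in> fst P \<and> v \<in> snd P" for z
        using edge_mem_biclique_edges[of v z "fst P" "snd P"] by simp
      \<comment> \<open>The neighbours of \<open>v\<close> form the part opposite to it. By
        disjointness that part omits \<open>v\<close>, so removing \<open>v\<close> from
        \<open>Z\<close> loses nothing.\<close>
      have "{z \<in> Z - {v}. {v, z} \<in> biclique_edges P} =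
          (if v \<in> fst P then Z \<inter> snd P else if v \<in> snd P then Z \<inter> fst P else {})"
        using disj by (auto simp: *)
      then show ?thesis
        using ev P by simp
    qed
    then have "even (\<Sum>z\<in>Z - {v}. ?s z)"
      using finZ by (intro even_sum_size_filter_mset) auto
    moreover have "odd (?s z)" if "z \<in> Z - {v}" for z
    proof -
      have "{v, z} \<in> complete_edges V"
        using that Z(1) v by (auto simp: complete_edges_def card_2_iff)
      then show ?thesis
        using assms(1) by (auto simp: odd_cover_def)
    qed
    then have "{z \<in> Z - {v}. odd (?s z)} = Z - {v}"
      by auto
    ultimately show ?thesis
      using finZ by (simp add: even_sum_iff)
  qed
  have "odd (card Z)"
  proof -
    obtain v where "v \<in> Z" using Z(2) by auto
    then show ?thesis
      using even_Z[of v] finZ Z(1) card_Suc_Diff1[of Z v] by (metis even_Suc subsetD)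
  qed
  \<comment> \<open>A vertex \<open>v\<close> outside \<open>Z\<close> would give
    \<open>Z - {v} = Z\<close>, of even size.\<close>
  moreover have "Z = V"
    using Z(1) even_Z calculation by (metis Diff_empty Diff_insert0 subsetI subset_antisym)
  ultimately show False
    using assms(3) by simp
qed

section \<open>Upper bound: parity by involution, linear algebra over F_3\<close>

text \<open>All points except \<open>a\<close> fall into pairs \<open>{x, h x}\<close>; the
  induction removes one such pair at a time.\<close>

lemma odd_card_involution:
  assumes "finite S" and "h ` S \<subseteq> S" and "\<And>x. x \<in> S \<Longrightarrow> h (h x) = x"
    and "a \<in> S" and "\<And>x. x \<in> S \<Longrightarrow> h x = x \<longleftrightarrow> x = a"
  shows "odd (card S)"
  using assms
proof (induction S rule: finite_psubset_induct)
  case (psubset S)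
  show ?case
  proof (cases "S = {a}")
    case False
    then obtain x where x: "x \<in> S" "x \<noteq> a"
      using psubset.prems by blast
    define T where "T = S - {x, h x}"
    have hx: "h x \<in> S" "h x \<noteq> x" "h x \<noteq> a"
      using x psubset.prems by (auto, metis)
    have "h ` T \<subseteq> T"
      using psubset.prems(1,2) x(1) unfolding T_def by (auto, metis)
    moreover have "T \<subset> S" "a \<in> T"
      using x hx psubset.prems by (auto simp: T_def)
    ultimately have "odd (card T)"
      using psubset.prems by (intro psubset.IH) (auto simp: T_def)
    moreover have "card S = card T + 2"
    proof -
      have "S = T \<union> {x, h x}" "T \<inter> {x, h x} = {}"
        using x hx by (auto simp: T_def)
      then show ?thesis
        using hx psubset.hyps by (metis card_2_iff card_Un_disjoint finite_Un)
    qed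
    ultimately show ?thesis
      by simp
  qed simp
qed

lemma mod3_cases: "x = 0 \<or> x = 1 \<or> x = (2 :: 3)"
proof (cases x)
  case (of_int z)
  then have "z = 0 \<or> z = 1 \<or> z = 2"
    by auto
  with of_int show ?thesis
    by auto
qed

lemma mod3_two_eq: "(2 :: 3) = - 1"
  by simp


text \<open>Padding with zeros, rather than with \<open>undefined\<close>, keeps the vectors closed
  under the pointwise operations on functions. Through \<open>dot\<close> they also serve as the
  functionals.\<close>

definition vecs :: "nat \<Rightarrow> (nat \<Rightarrow> 3) set" where
  "vecs k = {f. \<forall>i\<ge>k. f i = 0}"

definition dot :: "nat \<Rightarrow> (nat \<Rightarrow> 3) \<Rightarrow> (nat \<Rightarrow> 3) \<Rightarrow> 3" where
  "dot k f u = (\<Sum>i<k. f i * u i)"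

lemma dot_simps [simp]:
  "dot k (f + g) u = dot k f u + dot k g u"
  "dot k (- f) u = - dot k f u"
  "dot k (f - g) u = dot k f u - dot k g u"
  "dot k f (u + v) = dot k f u + dot k f v"
  "dot k f (u - v) = dot k f u - dot k f v"
  by (simp_all add: dot_def algebra_simps sum.distrib sum_negf sum_subtractf)

lemma dot_single: "i < k \<Longrightarrow> dot k (\<lambda>j. if j = i then c else 0) u = c * u i"
  by (simp add: dot_def if_distrib[of "\<lambda>x. x * _"] cong: if_cong)

lemma vecs_closed [simp]:
  "f \<in> vecs k \<Longrightarrow> g \<in> vecs k \<Longrightarrow> f + g \<in> vecs k"
  "f \<in> vecs k \<Longrightarrow> g \<in> vecs k \<Longrightarrow> f - g \<in> vecs k"
  "- f \<in> vecs k \<longleftrightarrow> f \<in> vecs k"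
  "0 \<in> vecs k"
  by (simp_all add: vecs_def)

lemma bij_betw_vecs: "bij_betw (\<lambda>f i. if i < k then f i else 0) ({..<k} \<rightarrow>\<^sub>E UNIV) (vecs k)"
  by (rule bij_betw_byWitness[where f' = "\<lambda>f. restrict f {..<k}"])
    (auto simp: vecs_def fun_eq_iff PiE_def extensional_def restrict_def)

lemma finite_vecs [simp]: "finite (vecs k)"
  using bij_betw_finite[OF bij_betw_vecs[of k]] by (simp add: finite_PiE)

lemma card_vecs: "card (vecs k) = 3 ^ k"
  using bij_betw_same_card[OF bij_betw_vecs[of k]] by (simp add: card_funcsetE)

lemma vecs_nonzeroE:
  assumes "f \<in> vecs k" and "f \<noteq> 0"
  obtains i where "i < k" and "f i \<noteq> 0"
  using assms by (auto simp: vecs_def fun_eq_iff) (metis not_le)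

text \<open>
  If \<open>s i \<noteq> 0\<close>, the vectors \<open>e\<^sub>j - s i * s j * e\<^sub>i\<close> span the orthogonal complement
  of \<open>s\<close>, because \<open>s i * s i = 1\<close>.
\<close>

lemma ex_separating_functional:
  assumes s: "s \<in> vecs k" and d: "d \<in> vecs k"
    and ne: "d \<noteq> 0" "d \<noteq> s" "d \<noteq> - s"
  shows "\<exists>f\<in>vecs k. dot k f s = 0 \<and> dot k f d = 1"
proof -
  have "\<exists>f\<in>vecs k. dot k f s = 0 \<and> dot k f d \<noteq> 0"
  proof (cases "s = 0")
    case True
    obtain i where i: "i < k" "d i \<noteq> 0"
      using d ne(1) by (rule vecs_nonzeroE)
    show ?thesis
      using i True by (intro bexI[of _ "\<lambda>j. if j = i then 1 else 0"])
        (auto simp: dot_single vecs_def)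
  next
    case False
    with s obtain i where i: "i < k" "s i \<noteq> 0"
      by (rule vecs_nonzeroE)
    have sq: "s i * s i = 1"
      using i(2) mod3_cases[of "s i"] by auto
    \<comment> \<open>Otherwise \<open>d\<close> is a multiple of \<open>s\<close>, and the only
      factors 0, 1 and -1 are excluded by \<open>ne\<close>.\<close>
    have "\<exists>j<k. d j \<noteq> s i * d i * s j"
    proof (rule ccontr)
      assume "\<not> ?thesis"
      then have "d j = s i * d i * s j" for j
        using s d by (cases "j < k") (simp_all add: vecs_def)
      then have "d = (\<lambda>j. s i * d i * s j)"
        by (rule ext)
      moreover have "s i * d i = 0 \<or> s i * d i = 1 \<or> s i * d i = - 1"
        using mod3_cases[of "s i * d i"] by (simp add: mod3_two_eq)
      ultimately have "d = (\<lambda>j. 0) \<or> d = s \<or> d = (\<lambda>j. - s j)"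
        by (elim disjE) simp_all
      then show False
        using ne by (auto simp: fun_eq_iff)
    qed
    then obtain j where j: "j < k" "d j \<noteq> s i * d i * s j"
      by blast
    define f :: "nat \<Rightarrow> 3" where
      "f = (\<lambda>l. if l = j then 1 else 0) - (\<lambda>l. if l = i then s i * s j else 0)"
    have "dot k f s = s j - s i * s i * s j"
      using i j by (simp add: f_def dot_single algebra_simps)
    then have "dot k f s = 0"
      by (simp add: sq)
    moreover have "dot k f d \<noteq> 0"
      using i j by (simp add: f_def dot_single algebra_simps)
    moreover have "f \<in> vecs k"
      using i j by (auto simp: f_def vecs_def)
    ultimately show ?thesis
      by blast
  qed
  then obtain f where f: "f \<in> vecs k" "dot k f s = 0" "dot k f d \<noteq> 0"
    by blast
  \<comment> \<open>A change of sign normalises the value to 1.\<close>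
  consider "dot k f d = 1" | "dot k f d = - 1"
    using f(3) mod3_cases[of "dot k f d"] by (auto simp: mod3_two_eq)
  then show ?thesis
    by cases (use f in \<open>auto intro: bexI[of _ f] bexI[of _ "- f"]\<close>)
qed

text \<open>The two equations amount to \<open>f\<close> vanishing on \<open>u + v\<close> and being
  -1 on \<open>u - v\<close>. This form also covers \<open>v = - u\<close>, where \<open>u\<close>
  and \<open>v\<close> are dependent but \<open>u + v = 0\<close>.\<close>

lemma odd_card_dot_eq:
  assumes u: "u \<in> vecs k" "u \<noteq> 0" and v: "v \<in> vecs k" "v \<noteq> 0" and "u \<noteq> v"
  shows "odd (card {f \<in> vecs k. dot k f u = 1 \<and> dot k f v = - 1})" (is "odd (card ?S)")
proof -
  have double: "x + x = - x" for x :: 3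
    using mod3_cases[of x] by auto
  have "u - v \<noteq> 0" "u - v \<noteq> u + v" "u - v \<noteq> - (u + v)"
  proof -
    have double: "w + w = - w" for w :: "nat \<Rightarrow> 3"
      using double by (simp add: fun_eq_iff)
    have "w = 0" if "w = - w" for w :: "nat \<Rightarrow> 3"
      using double[of w] that by (metis add_cancel_right_right)
    then show "u - v \<noteq> 0" "u - v \<noteq> u + v" "u - v \<noteq> - (u + v)"
      using u(2) v(2) \<open>u \<noteq> v\<close> by (auto simp: algebra_simps)
  qed
  then obtain g where g: "g \<in> vecs k" "dot k g (u + v) = 0" "dot k g (u - v) = 1"
    using ex_separating_functional[of "u + v" k "u - v"] u v by auto
  define a where "a = - g"
  have a: "a \<in> ?S"
    using g mod3_cases[of "dot k g u"] mod3_cases[of "dot k g v"] by (auto simp: a_def)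
  show ?thesis
  \<comment> \<open>The reflection \<open>2 a - f\<close> in \<open>a\<close>, since 2 = -1.\<close>
  proof (rule odd_card_involution[where h = "\<lambda>f. - a - f" and a = a])
    show "(- a - f = f) = (f = a)" for f
    proof -
      have "- x - y = y \<longleftrightarrow> y = x" for x y :: 3
        using mod3_cases[of x] mod3_cases[of y] by auto
      then show ?thesis
        by (simp add: fun_eq_iff)
    qed
  qed (use a in auto)
qed

section \<open>Upper bound: the cover by functionals up to sign\<close>

lemma ex_half_system:
  "\<exists>R. vecs k - {0} = R \<union> uminus ` R \<and> R \<inter> uminus ` R = {}"
proof -
  \<comment> \<open>Negation flips the first nonzero coordinate, so requiring it to be 1 selects one
    vector from each pair of opposites.\<close>
  define lead where "lead f = f (LEAST i. f i \<noteq> 0)" for f :: "nat \<Rightarrow> 3"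
  define R where "R = {f \<in> vecs k - {0}. lead f = 1}"
  have lead: "lead (- f) = - lead f" for f
    by (simp add: lead_def)
  have "lead f \<noteq> 0" if "f \<noteq> 0" for f
  proof -
    have "\<exists>i. f i \<noteq> 0" using that by (auto simp: fun_eq_iff)
    then show ?thesis unfolding lead_def by (rule LeastI_ex)
  qed
  then have "lead f = 1 \<or> lead f = - 1" if "f \<noteq> 0" for f
    using mod3_cases[of "lead f"] that by (auto simp: mod3_two_eq)
  then have "vecs k - {0} \<subseteq> R \<union> uminus ` R"
    by (auto simp: R_def lead image_iff intro: bexI[of _ "- _"])
      (metis lead minus_minus neg_0_equal_iff_equal vecs_closed(3))
  then have "vecs k - {0} = R \<union> uminus ` R"
    by (auto simp: R_def)
  moreover have "R \<inter> uminus ` R = {}"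
    by (auto simp: R_def lead)
  ultimately show ?thesis
    by blast
qed

lemma ex_odd_cover_half:
  "\<exists>C. odd_cover {..<3 ^ k - 1 :: nat} C \<and> 2 * size C = 3 ^ k - 1"
proof -
  let ?n = "3 ^ k - 1 :: nat"
  obtain R where R: "vecs k - {0} = R \<union> uminus ` R" "R \<inter> uminus ` R = {}"
    using ex_half_system by blast
  have Rv: "R \<subseteq> vecs k" "finite R"
    using R(1) by (auto intro: finite_subset[OF _ finite_vecs[of k]])
  have "card R + card R = card (vecs k - {0})"
    unfolding R(1) using R(2) Rv by (subst card_Un_disjoint) (auto simp: card_image inj_on_def)
  then have card_R: "2 * card R = ?n"
    by (simp add: card_vecs)
  have "card {..<?n} = card (vecs k - {0})"
    by (simp add: card_vecs)
  then obtain w where w: "bij_betw w {..<?n} (vecs k - {0})"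
    using finite_same_card_bij[of "{..<?n}" "vecs k - {0}"] by auto
  define P where "P f = ({i. i < ?n \<and> dot k f (w i) = 1}, {i. i < ?n \<and> dot k f (w i) = - 1})" for f
  let ?C = "image_mset P (mset_set R)"
  have "odd (size {# Q \<in># ?C. e \<in> biclique_edges Q #})" if e: "e \<in> complete_edges {..<?n}" for e
  proof -
    obtain i j where ij: "e = {i, j}" "i \<noteq> j" "i < ?n" "j < ?n"
      using e unfolding complete_edges_def card_2_iff by auto
    let ?S = "{f \<in> vecs k. dot k f (w i) = 1 \<and> dot k f (w j) = - 1}"
    have wij: "w i \<in> vecs k" "w i \<noteq> 0" "w j \<in> vecs k" "w j \<noteq> 0" "w i \<noteq> w j"
      using w ij by (auto simp: bij_betw_def inj_on_def)
    \<comment> \<open>The edge may be crossed in either direction; exchanging its ends amounts to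
      negating \<open>f\<close>.\<close>
    have mem: "e \<in> biclique_edges (P f) \<longleftrightarrow> f \<in> ?S \<or> - f \<in> ?S" if "f \<in> R" for f
      using that Rv ij by (auto simp: P_def edge_mem_biclique_edges minus_equation_iff)
    have "0 \<notin> ?S"
      by (simp add: dot_def)
    then have S: "?S = (?S \<inter> R) \<union> uminus ` {f \<in> R. - f \<in> ?S}"
      using R(1) by (auto simp: set_eq_iff image_iff)
    have "card ?S = card (?S \<inter> R) + card {f \<in> R. - f \<in> ?S}"
      by (subst S, subst card_Un_disjoint) (use R(2) Rv in \<open>auto simp: card_image inj_on_def\<close>)
    \<comment> \<open>Disjoint, because \<open>f\<close> and \<open>- f\<close> cannot both take the
      value 1 at \<open>w i\<close>. So each member of \<open>?S\<close> accounts for exactly one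
      biclique.\<close>
    also have "\<dots> = card ((?S \<inter> R) \<union> {f \<in> R. - f \<in> ?S})"
      using Rv by (subst card_Un_disjoint) auto
    also have "(?S \<inter> R) \<union> {f \<in> R. - f \<in> ?S} = {f \<in> R. e \<in> biclique_edges (P f)}"
      using mem by auto
    also have "card \<dots> = size {# Q \<in># ?C. e \<in> biclique_edges Q #}"
      using Rv(2) by (simp add: filter_mset_image_mset filter_mset_mset_set)
    finally show ?thesis
      using odd_card_dot_eq[OF wij] by simp
  qed
  then have "odd_cover {..<?n} ?C"
    by (auto simp: odd_cover_def P_def)
  then show ?thesis
    using card_R by (intro exI[of _ ?C]) simp
qed

theorem corollary4:
  fixes k n :: nat
  assumes "k \<ge> 1"
    and "n = 3 ^ k - 1"
  shows "real (odd_cover_number n) = real n / 2"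
proof -
  obtain C where C: "odd_cover {..<n} C" "2 * size C = n"
    using ex_odd_cover_half[of k] assms(2) by auto
  obtain D where D: "odd_cover {..<n} D" "size D = odd_cover_number n"
    using odd_cover_number_attained by blast
  \<comment> \<open>The evenness of \<open>n\<close> required by the lower bound is read off from
    \<open>2 * size C = n\<close>.\<close>
  have "n \<le> 2 * size D"
    using card_le_odd_cover[OF D(1)] C(2) by (metis card_lessThan dvd_triv_left finite_lessThan)
  then have "2 * odd_cover_number n = n"
    using odd_cover_number_le[OF C(1)] C(2) D(2) by linarith
  then show ?thesis
    by linarith
qed

end
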